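(* For every $0\le\alpha\le 1$ there exist constants $c,C>0$ and bipartite graphs $G=(V,E)$ with arbitrarily large $|V|$ such that $|E|\ge c|V|^{2-\frac{\alpha}{\alpha+1}}$ and every pair of vertices of $G$ has $f$-sparse sub-bineighborhoods for $f(x)=Cx^{2-\alpha}$.
   Context: For a graph $G$ and vertex $v$, $N_G(v)$ denotes the set of neighbors of $v$. For disjoint vertex sets $U,V$, $G(U,V)$ is the bipartite graph with vertex set $U\cup V$ and edge set $\{uv\in E(G): u\in U, v\in V\}$. For a nonnegative nondecreasing $f:\mathbb{R}\to\mathbb{R}$, two vertices $u,v$ of $G$ have $f$-sparse sub-bineighborhoods if for every two disjoint subsets $U\subseteq N_G(u)\setminus\{v\}$ and $V\subseteq N_G(v)\setminus\{u\}$ we have $|E(G(U,V))|\le f(|U\cup V|)$. *)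

theory Defs
  imports Complex_Main
begin

record 'a ugraph =
  verts :: "'a set"
  edges :: "'a set set"

definition finite_simple_graph :: "'a ugraph \<Rightarrow> bool" where
  "finite_simple_graph G \<longleftrightarrow>
     finite (verts G) \<and> (\<forall>e\<in>edges G. e \<subseteq> verts G \<and> card e = 2)"

definition bipartite_graph :: "'a ugraph \<Rightarrow> bool" where
  "bipartite_graph G \<longleftrightarrow>
     (\<exists>A B. A \<union> B = verts G \<and> A \<inter> B = {} \<and>
        (\<forall>e\<in>edges G. \<exists>a\<in>A. \<exists>b\<in>B. e = {a, b}))"

definition neighbors :: "'a ugraph \<Rightarrow> 'a \<Rightarrow> 'a set" where
  "neighbors G v = {w \<in> verts G. {v, w} \<in> edges G}"

definition between :: "'a ugraph \<Rightarrow> 'a set \<Rightarrow> 'a set \<Rightarrow> 'a ugraph" where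
  "between G U W =
     \<lparr>verts = U \<union> W, edges = {e \<in> edges G. \<exists>u\<in>U. \<exists>w\<in>W. e = {u, w}}\<rparr>"

(* Only the values of f at nonnegative integers matter here. *)
definition sparse_sub_bineighborhoods ::
  "(real \<Rightarrow> real) \<Rightarrow> 'a ugraph \<Rightarrow> 'a \<Rightarrow> 'a \<Rightarrow> bool" where
  "sparse_sub_bineighborhoods f G u v \<longleftrightarrow>
     (\<forall>U W. U \<subseteq> neighbors G u - {v} \<and> W \<subseteq> neighbors G v - {u} \<and> U \<inter> W = {} \<longrightarrow>
        real (card (edges (between G U W))) \<le> f (real (card (U \<union> W))))"

end

theory Submission
  imports Defs "HOL-Real_Asymp.Real_Asymp"
begin

text \<open>
  For \<open>\<alpha> = 0\<close> take complete bipartite graphs. For \<open>\<alpha> > 0\<close> put \<open>d = n powr (1 / (\<alpha> + 1))\<close> and choose,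
  uniformly among all edge sets of size \<open>m = \<lfloor>n\<^sup>2 * d powr (-\<alpha>)\<rfloor>\<close> between two classes of size \<open>n\<close>,
  one that avoids every bad configuration. Such a configuration consists of \<open>i\<close>, \<open>j\<close> in opposite
  classes, a set \<open>X\<close> of \<open>s\<close> further vertices joined to \<open>i\<close> or \<open>j\<close>, and \<open>k > C * s powr (2 - \<alpha>)\<close>
  edges inside \<open>X\<close>. It prescribes \<open>s + k\<close> edges, so a given one occurs with probability at most
  \<open>p ^ (s + k)\<close> where \<open>p = m / n\<^sup>2 \<le> d powr (-\<alpha>)\<close>, and with \<open>C = 72 / \<alpha>\<close> the expected
  number of configurations is below 1. Vertices in the same class need no argument, as there are
  no edges between their neighbourhoods.
\<close>

section \<open>Counting edge sets of fixed size, and the union bound\<close>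

text \<open>Deleting \<open>F\<close> matches these sets with the subsets of \<open>P - F\<close> of
  size \<open>m - card F\<close>. Relative to \<open>card P choose m\<close>, each prescribed
  element then costs a factor (m - f) / (card P - f), which is at most m / card P. This replaces
  independence: a uniform \<open>m\<close>-subset contains \<open>F\<close> with probability at most
  p ^ card F.\<close>

lemma card_supersets_le:
  fixes P F :: "'a set"
  assumes "finite P" and "F \<subseteq> P" and "m \<le> card P"
  shows "real (card {E. E \<subseteq> P \<and> card E = m \<and> F \<subseteq> E})
    \<le> real (card P choose m) * (real m / real (card P)) ^ card F"
proof (cases "card F \<le> m")
  case False
  have none: "{E. E \<subseteq> P \<and> card E = m \<and> F \<subseteq> E} = {}"
    using False card_mono[OF finite_subset[OF _ assms(1)]] by blast
  show ?thesis unfolding none by simp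
next
  case True
  have finF: "finite F" using assms finite_subset by blast
  have "bij_betw (\<lambda>E. E - F) {E. E \<subseteq> P \<and> card E = m \<and> F \<subseteq> E}
      {D. D \<subseteq> P - F \<and> card D = m - card F}"
  proof (rule bij_betw_byWitness[where f' = "\<lambda>D. D \<union> F"])
    show "(\<lambda>D. D \<union> F) ` {D. D \<subseteq> P - F \<and> card D = m - card F} \<subseteq> {E. E \<subseteq> P \<and> card E = m \<and> F \<subseteq> E}"
    proof clarsimp
      fix D assume D: "D \<subseteq> P - F" "card D = m - card F"
      have "card (D \<union> F) = card D + card F"
        using D finF assms(1) by (intro card_Un_disjoint) (auto intro: finite_subset)
      then show "D \<subseteq> P \<and> F \<subseteq> P \<and> card (D \<union> F) = m" using D True assms(2) by auto
    qed
  qed (use finF in \<open>auto simp: card_Diff_subset\<close>)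
  then have "card {E. E \<subseteq> P \<and> card E = m \<and> F \<subseteq> E} = card {D. D \<subseteq> P - F \<and> card D = m - card F}"
    by (rule bij_betw_same_card)
  also have "\<dots> = (card P - card F) choose (m - card F)"
    using assms finF by (subst n_subsets) (auto simp: card_Diff_subset)
  finally have eq: "card {E. E \<subseteq> P \<and> card E = m \<and> F \<subseteq> E} = (card P - card F) choose (m - card F)" .
  have "real ((card P - f) choose (m - f)) \<le> real (card P choose m) * (real m / real (card P)) ^ f"
    if "f \<le> m" for f
    using that
  proof (induction f)
    case (Suc f)
    define a b where "a = card P - Suc f" and "b = m - Suc f"
    have ab: "card P - f = Suc a" "m - f = Suc b" "b \<le> a"
      using Suc.prems assms(3) by (auto simp: a_def b_def)
    have "real (Suc a) * real (a choose b) = real (Suc a choose Suc b) * real (Suc b)"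
      by (metis Suc_times_binomial_eq of_nat_mult)
    then have e: "real (a choose b) = real (Suc a choose Suc b) * (real (Suc b) / real (Suc a))"
      by (simp add: field_simps)
    have P: "real (card P) = real (Suc a) + real f" "real m = real (Suc b) + real f"
      using ab Suc.prems assms(3) by linarith+
    \<comment> \<open>Adding \<open>f\<close> to numerator and denominator of a fraction that is at
      most 1 does not decrease it.\<close>
    have "real (Suc b) / real (Suc a) \<le> real m / real (card P)"
      unfolding P using ab(3) by (simp add: divide_simps algebra_simps mult_right_mono)
    then have "real (a choose b)
        \<le> (real (card P choose m) * (real m / real (card P)) ^ f) * (real m / real (card P))"
      unfolding e using Suc.IH Suc.prems ab by (intro mult_mono) auto
    then show ?case by (simp add: a_def b_def mult_ac)
  qed simp
  then show ?thesis using True eq by simp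
qed

lemma choose_left_mono: "a \<le> b \<Longrightarrow> a choose k \<le> b choose k"
proof (induction b rule: dec_induct)
  case (step b)
  have "b choose k \<le> Suc b choose k" by (cases k) auto
  with step show ?case by simp
qed simp

lemma sum_over_subsets_by_card:
  fixes g :: "nat \<Rightarrow> real"
  assumes "finite S"
  shows "(\<Sum>X | X \<subseteq> S \<and> X \<noteq> {}. g (card X)) = (\<Sum>s=1..card S. real (card S choose s) * g s)"
proof -
  have "(\<Sum>X | X \<subseteq> S \<and> X \<noteq> {}. g (card X))
      = (\<Sum>s=1..card S. \<Sum>X | X \<in> {X. X \<subseteq> S \<and> X \<noteq> {}} \<and> card X = s. g (card X))"
    using assms
    by (intro sum.group[symmetric])
      (auto simp: card_mono Suc_le_eq card_gt_0_iff finite_subset[OF _ assms])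
  also have "\<dots> = (\<Sum>s=1..card S. \<Sum>X | X \<subseteq> S \<and> card X = s. g s)"
    by (intro sum.cong) auto
  finally show ?thesis using assms by (simp add: n_subsets)
qed

text \<open>First-moment argument written as counting: if every \<open>m\<close>-subset were bad,
  the bad families would cover all of them, although their sizes sum to less than the total. The
  threshold \<open>k\<close> is arbitrary here, and \<open>k s = 0\<close> forbids every
  configuration of size \<open>s\<close>.\<close>

lemma exists_locally_sparse_edge_set:
  fixes L R :: "'a set" and k :: "nat \<Rightarrow> nat"
  assumes fin: "finite L" "finite R" and disj: "L \<inter> R = {}" and m: "m \<le> card (L \<times> R)"
    and small: "real (card (L \<times> R)) * (\<Sum>s=1..card (L \<union> R). real (card (L \<union> R) choose s) *
      (real (s\<^sup>2 choose k s) * (real m / real (card (L \<times> R))) ^ (s + k s))) < 1"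
  shows "\<exists>E \<subseteq> L \<times> R. card E = m \<and>
    (\<forall>i\<in>L. \<forall>j\<in>R. \<forall>X \<subseteq> L \<union> R - {i, j}. X \<noteq> {} \<and> {i} \<times> (X \<inter> R) \<union> (X \<inter> L) \<times> {j} \<subseteq> E \<longrightarrow>
      card (E \<inter> (X \<times> X)) < k (card X))"
proof (rule ccontr)
  define P where "P = L \<times> R"
  define \<Omega> where "\<Omega> = {E. E \<subseteq> P \<and> card E = m}"
  define star where "star = (\<lambda>i j X. {i} \<times> (X \<inter> R) \<union> (X \<inter> L) \<times> {j})"
  define XX where "XX = (\<lambda>(i, j). {X. X \<subseteq> L \<union> R - {i, j} \<and> X \<noteq> {}})"
  define MM where "MM = (\<lambda>X. {M. M \<subseteq> (X \<inter> L) \<times> (X \<inter> R) \<and> card M = k (card X)})"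
  define Bad where "Bad = (\<lambda>(i, j) X M. {E. E \<subseteq> P \<and> card E = m \<and> star i j X \<union> M \<subseteq> E})"
  define p where "p = real m / real (card P)"
  define w where "w = (\<lambda>s. real (s\<^sup>2 choose k s) * p ^ (s + k s))"
  have p0: "p \<ge> 0" by (simp add: p_def)
  have w0: "w s \<ge> 0" for s using p0 by (simp add: w_def)
  have finP: "finite P" using fin by (simp add: P_def)
  have card\<Omega>: "card \<Omega> = card P choose m" unfolding \<Omega>_def by (rule n_subsets[OF finP])
  have pos: "card \<Omega> > 0" using m unfolding card\<Omega> P_def by simp
  have finXX: "finite (XX ij)" for ij using fin by (auto simp: XX_def split: prod.split)
  have finMM: "finite (MM X)" if "X \<in> XX ij" for X ij
    using fin by (auto simp: MM_def)
  assume neg: "\<not> ?thesis"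
  have "\<Omega> \<subseteq> (\<Union>ij\<in>P. \<Union>X\<in>XX ij. \<Union>M\<in>MM X. Bad ij X M)"
  proof
    fix E assume E: "E \<in> \<Omega>"
    with neg obtain i j X where ij: "i \<in> L" "j \<in> R" and X: "X \<subseteq> L \<union> R - {i, j}" "X \<noteq> {}"
      and st: "star i j X \<subseteq> E" and ge: "k (card X) \<le> card (E \<inter> (X \<times> X))"
      unfolding \<Omega>_def P_def star_def by (smt (verit) mem_Collect_eq not_less)
    \<comment> \<open>Keeping exactly \<open>k (card X)\<close> of the inner edges makes the number
      of prescribed edges depend only on the size of \<open>X\<close>.\<close>
    obtain M where M: "M \<subseteq> E \<inter> (X \<times> X)" "card M = k (card X)"
      using obtain_subset_with_card_n[OF ge] by metis
    have "M \<in> MM X" using M E by (auto simp: MM_def \<Omega>_def P_def)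
    moreover have "E \<in> Bad (i, j) X M" using E st M by (auto simp: Bad_def \<Omega>_def)
    moreover have "X \<in> XX (i, j)" using X by (auto simp: XX_def)
    moreover have "(i, j) \<in> P" using ij by (simp add: P_def)
    ultimately show "E \<in> (\<Union>ij\<in>P. \<Union>X\<in>XX ij. \<Union>M\<in>MM X. Bad ij X M)" by blast
  qed
  moreover have "finite (Bad ij X M)" for ij X M
    using finP by (auto simp: Bad_def split: prod.split intro: finite_subset[of _ "Pow P"])
  ultimately have "card \<Omega> \<le> card (\<Union>ij\<in>P. \<Union>X\<in>XX ij. \<Union>M\<in>MM X. Bad ij X M)"
    using finP finXX finMM by (intro card_mono) blast+
  also have "\<dots> \<le> (\<Sum>ij\<in>P. \<Sum>X\<in>XX ij. \<Sum>M\<in>MM X. card (Bad ij X M))"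
    by (intro order_trans[OF card_UN_le] sum_mono finP finXX finMM)+ auto
  finally have "real (card \<Omega>) \<le> (\<Sum>ij\<in>P. \<Sum>X\<in>XX ij. \<Sum>M\<in>MM X. real (card (Bad ij X M)))"
    by (simp flip: of_nat_sum)
  also have "\<dots> \<le> (\<Sum>ij\<in>P. \<Sum>X\<in>XX ij. real (card \<Omega>) * w (card X))"
  proof (intro sum_mono)
    fix ij X assume "ij \<in> P" and X: "X \<in> XX ij"
    then obtain i j where ij: "ij = (i, j)" "i \<in> L" "j \<in> R" by (auto simp: P_def)
    have X': "X \<subseteq> L \<union> R - {i, j}" "finite X"
      using X fin by (auto simp: XX_def ij intro: finite_subset)
    have XLR: "card X = card (X \<inter> R) + card (X \<inter> L)"
      using X' disj by (subst card_Un_disjoint[symmetric]) (auto intro: arg_cong[where f = card])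
    have bad: "real (card (Bad ij X M)) \<le> real (card \<Omega>) * p ^ (card X + k (card X))" if "M \<in> MM X" for M
    proof -
      have M: "M \<subseteq> (X \<inter> L) \<times> (X \<inter> R)" "card M = k (card X)" "finite M"
        using that X' by (auto simp: MM_def intro: finite_subset[of _ "(X \<inter> L) \<times> (X \<inter> R)"])
      have "card (star i j X) = card ({i} \<times> (X \<inter> R)) + card ((X \<inter> L) \<times> {j})"
        unfolding star_def using X' by (intro card_Un_disjoint) auto
      then have "card (star i j X) = card X" by (simp add: XLR card_cartesian_product)
      \<comment> \<open>Edges of \<open>M\<close> have both ends in \<open>X\<close>, while each
        star edge uses \<open>i\<close> or \<open>j\<close>, which \<open>X\<close> omits.\<close>
      moreover have "card (star i j X \<union> M) = card (star i j X) + card M"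
        using X' M by (intro card_Un_disjoint) (auto simp: star_def)
      ultimately have c: "card (star i j X \<union> M) = card X + k (card X)" by (simp add: M)
      have "star i j X \<union> M \<subseteq> P" using M ij by (auto simp: star_def P_def)
      from card_supersets_le[OF finP this, of m] show ?thesis
        using m unfolding c card\<Omega> ij Bad_def p_def P_def by simp
    qed
    have "card (MM X) = (card ((X \<inter> L) \<times> (X \<inter> R)) choose k (card X))"
      unfolding MM_def using X' by (intro n_subsets) auto
    also have "\<dots> \<le> ((card X)\<^sup>2 choose k (card X))"
      using X' by (intro choose_left_mono) (auto simp: power2_eq_square card_cartesian_product intro!: mult_mono card_mono)
    finally have cM: "card (MM X) \<le> (card X)\<^sup>2 choose k (card X)" .
    have "(\<Sum>M\<in>MM X. real (card (Bad ij X M)))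
        \<le> real (card (MM X)) * (real (card \<Omega>) * p ^ (card X + k (card X)))"
      by (rule sum_bounded_above[OF bad])
    also have "\<dots> \<le> real ((card X)\<^sup>2 choose k (card X)) * (real (card \<Omega>) * p ^ (card X + k (card X)))"
      using cM p0 by (intro mult_right_mono) auto
    finally show "(\<Sum>M\<in>MM X. real (card (Bad ij X M))) \<le> real (card \<Omega>) * w (card X)"
      by (simp add: w_def mult_ac)
  qed
  \<comment> \<open>Allowing \<open>X\<close> to contain \<open>i\<close> and \<open>j\<close> makes
    the inner sum the same for all pairs, ready for grouping by size.\<close>
  also have "\<dots> \<le> (\<Sum>ij\<in>P. \<Sum>X | X \<subseteq> L \<union> R \<and> X \<noteq> {}. real (card \<Omega>) * w (card X))"
    using fin w0 by (intro sum_mono sum_mono2) (auto simp: XX_def)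
  also have "\<dots> = real (card \<Omega>) * (real (card P) * (\<Sum>s=1..card (L \<union> R). real (card (L \<union> R) choose s) * w s))"
    using fin by (simp add: sum_over_subsets_by_card flip: sum_distrib_left)
  finally show False
    using small pos unfolding w_def p_def P_def by (simp add: mult_le_cancel_left1)
qed

text \<open>The usual bound (e a / k) ^ k with e replaced by 3. It combines a ^ k / k! as an upper
  bound for the binomial with k ^ k / k! \<le> e ^ k, where the left side is one term of the
  exponential series at k.\<close>

lemma binomial_le_exp_pow:
  assumes "k > 0"
  shows "real (a choose k) \<le> (3 * real a / real k) ^ k"
proof -
  have "real k ^ k / fact k \<le> exp (real k)"
    using sum_le_suminf[OF summable_exp, of "{k}" "real k"]
    by (simp add: exp_def divide_inverse mult.commute)
  also have "\<dots> = exp 1 ^ k" by (simp flip: exp_of_nat_mult)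
  also have "\<dots> \<le> 3 ^ k" using exp_le by (intro power_mono) auto
  finally have k: "real k ^ k \<le> 3 ^ k * fact k" by (simp add: divide_simps)
  have "real (a choose k) * fact k \<le> real a ^ k"
    using binomial_fact_pow[of a k] by (metis of_nat_fact of_nat_le_iff of_nat_mult of_nat_power)
  then have "real (a choose k) * fact k * real k ^ k \<le> real a ^ k * (3 ^ k * fact k)"
    using k by (intro mult_mono) auto
  then have "real (a choose k) * real k ^ k \<le> (3 * real a) ^ k"
    by (simp add: power_mult_distrib mult_ac)
  then show ?thesis using assms by (simp add: power_divide pos_le_divide_eq)
qed

section \<open>From sets of pairs to bipartite graphs\<close>

text \<open>Edges are kept as pairs directed from \<open>L\<close> to \<open>R\<close>, so that edge
  sets are subsets of a product and can be counted there; for disjoint classes, forgetting the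
  direction loses nothing.\<close>

definition edge_graph :: "'a set \<Rightarrow> 'a set \<Rightarrow> ('a \<times> 'a) set \<Rightarrow> 'a ugraph" where
  "edge_graph L R E = \<lparr>verts = L \<union> R, edges = (\<lambda>(i, j). {i, j}) ` E\<rparr>"

lemma verts_edge_graph [simp]: "verts (edge_graph L R E) = L \<union> R"
  by (simp add: edge_graph_def)

lemma doubleton_in_edges_edge_graph:
  "{a, b} \<in> edges (edge_graph L R E) \<longleftrightarrow> (a, b) \<in> E \<or> (b, a) \<in> E"
  by (force simp: edge_graph_def doubleton_eq_iff)

lemma finite_simple_edge_graph:
  assumes "finite L" "finite R" "L \<inter> R = {}" "E \<subseteq> L \<times> R"
  shows "finite_simple_graph (edge_graph L R E)"
proof -
  have "{i, j} \<subseteq> L \<union> R \<and> card {i, j} = 2" if "(i, j) \<in> E" for i j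
  proof -
    have "i \<in> L" "j \<in> R" using that assms by auto
    then show ?thesis using assms(3) by (auto simp: card_insert_if)
  qed
  then show ?thesis
    using assms by (auto simp: finite_simple_graph_def edge_graph_def)
qed

lemma bipartite_edge_graph:
  assumes "L \<inter> R = {}" "E \<subseteq> L \<times> R"
  shows "bipartite_graph (edge_graph L R E)"
  unfolding bipartite_graph_def using assms
  by (intro exI[of _ L] exI[of _ R]) (fastforce simp: edge_graph_def)

lemma card_edges_edge_graph:
  assumes "L \<inter> R = {}" "E \<subseteq> L \<times> R"
  shows "card (edges (edge_graph L R E)) = card E"
proof -
  have "inj_on (\<lambda>(i, j). {i, j}) E"
    using assms by (auto simp: inj_on_def doubleton_eq_iff; blast)
  then show ?thesis by (simp add: edge_graph_def card_image)
qed

lemma sparse_sub_bineighborhoods_commute: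
  "sparse_sub_bineighborhoods f G u v \<longleftrightarrow> sparse_sub_bineighborhoods f G v u"
proof -
  have "edges (between G U W) = edges (between G W U)" for U W
    by (auto simp: between_def insert_commute)
  then show ?thesis
    unfolding sparse_sub_bineighborhoods_def by (metis Int_commute Un_commute)
qed

text \<open>A single set \<open>X\<close> encodes both sub-neighbourhoods: for disjoint classes,
  \<open>X \<inter> R\<close> lies in the neighbourhood of \<open>i\<close> and
  \<open>X \<inter> L\<close> in that of \<open>j\<close>. This matches the configurations of the
  union bound.\<close>

definition locally_sparse :: "(real \<Rightarrow> real) \<Rightarrow> 'a set \<Rightarrow> 'a set \<Rightarrow> ('a \<times> 'a) set \<Rightarrow> bool" where
  "locally_sparse f L R E \<longleftrightarrow>
    (\<forall>i\<in>L. \<forall>j\<in>R. \<forall>X \<subseteq> L \<union> R - {i, j}. X \<noteq> {} \<and> {i} \<times> (X \<inter> R) \<union> (X \<inter> L) \<times> {j} \<subseteq> E \<longrightarrow>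
      real (card (E \<inter> X \<times> X)) \<le> f (real (card X)))"

text \<open>For \<open>u\<close> in \<open>L\<close> and \<open>v\<close> in \<open>R\<close>, local
  sparsity is applied to \<open>X = U \<union> W\<close>; the reverse order follows by symmetry. If
  \<open>X\<close> is empty or \<open>u\<close> and \<open>v\<close> share a class, there are no
  edges between \<open>U\<close> and \<open>W\<close>, and \<open>f\<close> being nonnegative
  suffices.\<close>

lemma sparse_edge_graph:
  assumes fin: "finite L" "finite R" and disj: "L \<inter> R = {}" and E: "E \<subseteq> L \<times> R"
    and f0: "\<And>x. f x \<ge> 0"
    and sparse: "locally_sparse f L R E"
    and uv: "u \<in> L \<union> R" "v \<in> L \<union> R"
  shows "sparse_sub_bineighborhoods f (edge_graph L R E) u v"
proof -
  let ?G = "edge_graph L R E"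
  have nbL: "neighbors ?G u = {j. (u, j) \<in> E}" "neighbors ?G u \<subseteq> R" if "u \<in> L" for u
    using that E disj by (auto simp: neighbors_def doubleton_in_edges_edge_graph)
  have nbR: "neighbors ?G v = {i. (i, v) \<in> E}" "neighbors ?G v \<subseteq> L" if "v \<in> R" for v
    using that E disj by (auto simp: neighbors_def doubleton_in_edges_edge_graph)
  have empty: "edges (between ?G U W) = {}" if "U \<subseteq> L \<and> W \<subseteq> L \<or> U \<subseteq> R \<and> W \<subseteq> R" for U W
    using that E disj by (fastforce simp: between_def doubleton_in_edges_edge_graph)
  have LR: "sparse_sub_bineighborhoods f ?G u v" if u: "u \<in> L" and v: "v \<in> R" for u v
    unfolding sparse_sub_bineighborhoods_def
  proof (intro allI impI, elim conjE)
    fix U W assume U: "U \<subseteq> neighbors ?G u - {v}" and W: "W \<subseteq> neighbors ?G v - {u}" and "U \<inter> W = {}"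
    show "real (card (edges (between ?G U W))) \<le> f (real (card (U \<union> W)))"
    proof (cases "U \<union> W = {}")
      case True
      then show ?thesis using f0 empty[of U W] by simp
    next
      case False
      have UR: "U \<subseteq> R" and WL: "W \<subseteq> L" using U W nbL nbR u v by blast+
      have "edges (between ?G U W) \<subseteq> (\<lambda>(i, j). {i, j}) ` (E \<inter> (U \<union> W) \<times> (U \<union> W))"
        by (fastforce simp: between_def edge_graph_def doubleton_eq_iff)
      moreover have finE: "finite (E \<inter> (U \<union> W) \<times> (U \<union> W))"
        using E fin finite_subset by blast
      ultimately have "card (edges (between ?G U W)) \<le> card (E \<inter> (U \<union> W) \<times> (U \<union> W))"
        by (meson card_image_le card_mono finite_imageI order_trans)
      \<comment> \<open>By definition \<open>U\<close> omits only \<open>v\<close> and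
        \<open>W\<close> only \<open>u\<close>; the other two exclusions hold because
        \<open>U\<close> lies in \<open>R\<close> and \<open>W\<close> in \<open>L\<close>.\<close>
      moreover have "U \<union> W \<subseteq> L \<union> R - {u, v}"
        using U W UR WL u v disj by blast
      moreover have "{u} \<times> ((U \<union> W) \<inter> R) \<union> ((U \<union> W) \<inter> L) \<times> {v} \<subseteq> E"
        using U W UR WL nbL(1)[OF u] nbR(1)[OF v] disj by auto
      ultimately show ?thesis
        using sparse u v False unfolding locally_sparse_def by (meson of_nat_le_iff order_trans)
    qed
  qed
  have same: "sparse_sub_bineighborhoods f ?G u v" if "u \<in> L \<and> v \<in> L \<or> u \<in> R \<and> v \<in> R"
    unfolding sparse_sub_bineighborhoods_def
  proof (intro allI impI, elim conjE)
    fix U W assume "U \<subseteq> neighbors ?G u - {v}" "W \<subseteq> neighbors ?G v - {u}"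
    then have "edges (between ?G U W) = {}"
      using that nbL(2) nbR(2) by (intro empty) blast
    then show "real (card (edges (between ?G U W))) \<le> f (real (card (U \<union> W)))"
      using f0 by simp
  qed
  consider "u \<in> L \<and> v \<in> L \<or> u \<in> R \<and> v \<in> R" | "u \<in> L" "v \<in> R" | "v \<in> L" "u \<in> R"
    using uv by blast
  then show ?thesis
  proof cases
    case 3
    then have "sparse_sub_bineighborhoods f ?G v u" by (rule LR)
    then show ?thesis by (rule sparse_sub_bineighborhoods_commute[THEN iffD1])
  qed (simp_all add: LR same)
qed

section \<open>Numerical estimate of the union bound\<close>

text \<open>
  The number of edges a bad pair of neighbourhoods of total size \<open>s\<close> must span. The value \<open>0\<close>
  means that the size alone is already excluded: \<open>d\<close> bounds the average degree, and
  no two neighbourhoods together reach \<open>12 * d\<close> vertices.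
\<close>
definition excess :: "real \<Rightarrow> real \<Rightarrow> nat \<Rightarrow> nat" where
  "excess \<alpha> d s = (if real s \<ge> 12 * d then 0 else nat \<lfloor>72 / \<alpha> * real s powr (2 - \<alpha>)\<rfloor> + 1)"

text \<open>Three ranges of \<open>s\<close>. For s \<ge> 12 d the star edges alone give (1/2) ^ s.
  Below that, the inner edges bring the bound to (y ^ 71 / 2) ^ s with y = s / (12 d) \<le> 1: if s
  \<ge> sqrt d the factor 1/2 is enough, and if s < sqrt d then \<open>y\<close> itself is at most d
  powr (-1/2).\<close>

lemma union_bound_term:
  fixes \<alpha> d p :: real and n s :: nat
  assumes \<alpha>: "0 < \<alpha>" "\<alpha> \<le> 1" and d: "d \<ge> 1" and big: "(1/2) powr sqrt d \<le> d powr (-7)"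
    and p: "0 \<le> p" "p \<le> d powr (-\<alpha>)" "real n * p \<le> d" and s: "s \<ge> 1"
  shows "real (2 * n choose s) * (real (s\<^sup>2 choose excess \<alpha> d s) * p ^ (s + excess \<alpha> d s)) \<le> d powr (-7)"
proof -
  have half: "(1/2) ^ s \<le> d powr (-7)" if "sqrt d \<le> real s"
  proof -
    have "(1/2::real) ^ s = (1/2) powr real s" by (simp add: powr_realpow)
    also have "\<dots> \<le> (1/2) powr sqrt d" using that by (intro powr_mono') auto
    finally show ?thesis using big by simp
  qed
  have sqrt_d: "sqrt d \<le> d"
    using d self_le_power[of d 2] by (intro real_le_lsqrt) auto
  have "real (2 * n choose s) * p ^ s \<le> (3 * real (2 * n) / real s) ^ s * p ^ s"
    using binomial_le_exp_pow[of s "2 * n"] s p by (intro mult_right_mono) auto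
  also have "\<dots> = (6 * (real n * p) / real s) ^ s"
    unfolding power_mult_distrib[symmetric] by (rule arg_cong[where f = "\<lambda>x. x ^ s"]) simp
  also have "\<dots> \<le> (6 * d / real s) ^ s"
    using p by (intro power_mono divide_right_mono) auto
  finally have A: "real (2 * n choose s) * p ^ s \<le> (6 * d / real s) ^ s" .
  show ?thesis
  proof (cases "real s \<ge> 12 * d")
    case True
    have "(6 * d / real s) ^ s \<le> (1/2) ^ s"
      using True d s by (intro power_mono) (auto simp: field_simps)
    also have "\<dots> \<le> d powr (-7)" using half True sqrt_d d by simp
    finally show ?thesis using A True by (simp add: excess_def)
  next
    case False
    define k where "k = excess \<alpha> d s"
    \<comment> \<open>Normalised size, chosen so that the star bound 6 d / s equals 1 / (2
      y).\<close>
    define y where "y = real s / (12 * d)"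
    have y: "0 < y" "y \<le> 1" using False d s by (auto simp: y_def)
    have k: "72 / \<alpha> * real s powr (2 - \<alpha>) \<le> real k"
      using False \<alpha> unfolding k_def excess_def by simp linarith
    have k0: "k > 0" using False by (simp add: k_def excess_def)
    \<comment> \<open>Since 2 - \<alpha> \<ge> 1, the excess is at least linear: \<alpha> k \<ge> 72
      s. This later turns y powr (\<alpha> k) into at most y ^ (72 s).\<close>
    have "real s = real s powr 1" using s by simp
    also have "\<dots> \<le> real s powr (2 - \<alpha>)" using \<alpha> s by (intro powr_mono) auto
    finally have "72 / \<alpha> * real s \<le> real k"
      using k \<alpha> by (smt (verit) divide_nonneg_nonneg mult_left_mono)
    then have k': "72 * real s \<le> \<alpha> * real k" using \<alpha> by (simp add: field_simps)
    have ydef: "y powr \<alpha> = real s powr \<alpha> * 12 powr (-\<alpha>) * d powr (-\<alpha>)"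
      using d s by (simp add: y_def powr_divide powr_mult powr_minus_divide)
    have "(12::real) powr \<alpha> \<le> 12 powr 1" using \<alpha> by (intro powr_mono) auto
    then have "12 powr (-\<alpha>) \<ge> (1/12::real)" by (simp add: powr_minus_divide field_simps)
    \<comment> \<open>The constant 72 pays here for the 12 in \<open>y\<close>: 72 / \<alpha> * 12
      powr (-\<alpha>) \<ge> 72 / 12 = 6, more than the 3 from the binomial bound.\<close>
    have "3 * (real s)\<^sup>2 * p \<le> 3 * (real s)\<^sup>2 * d powr (-\<alpha>)"
      using p by (intro mult_left_mono) auto
    also have "\<dots> \<le> 6 * ((real s)\<^sup>2 * d powr (-\<alpha>))" by simp
    also have "\<dots> \<le> (72 / \<alpha> * 12 powr (-\<alpha>)) * ((real s)\<^sup>2 * d powr (-\<alpha>))"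
    proof (intro mult_right_mono)
      have "6 = 72 * (1/12::real)" by simp
      also have "\<dots> \<le> 72 / \<alpha> * 12 powr (-\<alpha>)"
        using \<alpha> \<open>12 powr (-\<alpha>) \<ge> (1/12::real)\<close> by (intro mult_mono) (auto simp: field_simps)
      finally show "6 \<le> 72 / \<alpha> * 12 powr (-\<alpha>)" .
    qed auto
    also have "\<dots> = y powr \<alpha> * (72 / \<alpha> * real s powr (2 - \<alpha>))"
    proof -
      have "real s powr \<alpha> * real s powr (2 - \<alpha>) = (real s)\<^sup>2"
        using s by (simp flip: powr_add add: powr_realpow)
      then show ?thesis unfolding ydef by (simp add: mult_ac)
    qed
    also have "\<dots> \<le> y powr \<alpha> * real k" using k by (intro mult_left_mono) auto
    finally have base: "3 * (real s)\<^sup>2 / real k * p \<le> y powr \<alpha>"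
      using k0 by (simp add: divide_simps)
    have "real (s\<^sup>2 choose k) * p ^ k \<le> (3 * real (s\<^sup>2) / real k) ^ k * p ^ k"
      using p by (intro mult_right_mono binomial_le_exp_pow k0) auto
    also have "\<dots> = (3 * (real s)\<^sup>2 / real k * p) ^ k" by (simp add: power_mult_distrib power_divide)
    also have "\<dots> \<le> (y powr \<alpha>) ^ k" using base p by (intro power_mono) auto
    also have "\<dots> = y powr (\<alpha> * real k)" using y by (simp add: powr_powr flip: powr_realpow)
    also have "\<dots> \<le> y powr (72 * real s)" using y k' by (intro powr_mono') auto
    also have "\<dots> = (y ^ 72) ^ s" using powr_realpow[of y "72 * s"] y by (simp add: power_mult)
    finally have B: "real (s\<^sup>2 choose k) * p ^ k \<le> (y ^ 72) ^ s" .
    have "real (2 * n choose s) * (real (s\<^sup>2 choose k) * p ^ (s + k))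
        = (real (2 * n choose s) * p ^ s) * (real (s\<^sup>2 choose k) * p ^ k)"
      by (simp add: power_add)
    \<comment> \<open>One of the 72 factors \<open>y\<close> cancels the 1 / y in the star bound; 71
      remain.\<close>
    also have "\<dots> \<le> (6 * d / real s) ^ s * (y ^ 72) ^ s"
      using A B p d by (intro mult_mono) auto
    also have "\<dots> = (y ^ 71 / 2) ^ s"
    proof -
      have "6 * d / real s * y ^ 72 = 1 / (2 * y) * y ^ 72" using d s by (simp add: y_def)
      also have "\<dots> = y ^ 71 / 2" using y power_Suc[of y 71] by simp
      finally show ?thesis by (simp only: power_mult_distrib[symmetric])
    qed
    also have "\<dots> \<le> d powr (-7)"
    proof (cases "sqrt d \<le> real s")
      case True
      have "(y ^ 71 / 2) ^ s \<le> (1 / 2) ^ s"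
        using y by (intro power_mono divide_right_mono power_le_one) auto
      then show ?thesis using half[OF True] by simp
    next
      case False
      have "y \<le> sqrt d / d" using False d s unfolding y_def by (intro frac_le) auto
      also have "\<dots> = d powr (-1/2)"
        using d by (simp add: powr_minus_divide powr_half_sqrt field_simps)
      finally have y': "y \<le> d powr (-1/2)" .
      \<comment> \<open>As \<open>s\<close> may be as small as 1, only one of the \<open>s\<close>
        factors is kept. Fourteen powers of \<open>y\<close> already give d powr (-7).\<close>
      have "y ^ 71 / 2 \<le> 1" using y power_le_one[of y 71] by simp
      then have "(y ^ 71 / 2) ^ s \<le> y ^ 71 / 2"
        using y s power_decreasing[of 1 s "y ^ 71 / 2"] by simp
      also have "\<dots> \<le> y ^ 71" using y by simp
      also have "\<dots> \<le> y ^ 14" using y by (intro power_decreasing) auto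
      also have "\<dots> \<le> (d powr (-1/2)) ^ 14" using y y' by (intro power_mono) auto
      also have "\<dots> = d powr (-7)" using d by (simp add: powr_powr flip: powr_realpow)
      finally show ?thesis .
    qed
    finally show ?thesis by (simp add: k_def)
  qed
qed

text \<open>With d = n powr (1 / (\<alpha> + 1)), the density d powr (-\<alpha>) makes the average
  degree at most \<open>d\<close>. As \<alpha> \<le> 1, also n \<le> d^2, so the n^2 pairs and 2 n
  sizes contribute a factor 2 n^3 \<le> 2 d^6. Terms of at most d powr (-7) leave 2 / d < 1.\<close>

lemma exists_locally_sparse_powr:
  fixes \<alpha> :: real and N :: nat
  assumes \<alpha>: "0 < \<alpha>" "\<alpha> \<le> 1"
  obtains n E where "n \<ge> N" "n \<ge> 1" "E \<subseteq> {..<n} \<times> {n..<2 * n}"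
    "real n powr (2 - \<alpha> / (\<alpha> + 1)) / 2 \<le> real (card E)"
    "locally_sparse (\<lambda>x. 72 / \<alpha> * x powr (2 - \<alpha>)) {..<n} {n..<2 * n} E"
proof -
  have "eventually (\<lambda>d. d > 2 \<and> (1/2) powr sqrt d \<le> d powr (-7)) (at_top :: real filter)"
    by (intro eventually_conj eventually_gt_at_top) real_asymp
  moreover have "filterlim (\<lambda>n. real n powr (1 / (\<alpha> + 1))) at_top sequentially"
    using \<alpha> by real_asymp
  ultimately have ev: "eventually (\<lambda>n. real n powr (1 / (\<alpha> + 1)) > 2 \<and>
      (1/2) powr sqrt (real n powr (1 / (\<alpha> + 1))) \<le> (real n powr (1 / (\<alpha> + 1))) powr (-7)) sequentially"
    by (rule eventually_compose_filterlim)
  obtain n where n: "n \<ge> N" "n \<ge> 1" and d2: "real n powr (1 / (\<alpha> + 1)) > 2"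
    and big: "(1/2) powr sqrt (real n powr (1 / (\<alpha> + 1))) \<le> (real n powr (1 / (\<alpha> + 1))) powr (-7)"
    using eventually_happens'[OF sequentially_bot eventually_conj[OF ev eventually_ge_at_top[of "max N 1"]]]
    by auto
  define d where "d = real n powr (1 / (\<alpha> + 1))"
  have d: "d > 2" and big': "(1/2) powr sqrt d \<le> d powr (-7)"
    using d2 big unfolding d_def by blast+
  \<comment> \<open>This equals n^2 d powr (-\<alpha>), the intended number of edges before
    rounding.\<close>
  define x where "x = real n powr (2 - \<alpha> / (\<alpha> + 1))"
  define m where "m = nat \<lfloor>x\<rfloor>"
  define p where "p = real m / (real n)\<^sup>2"
  let ?L = "{..<n}" and ?R = "{n..<2 * n}"
  have "?L \<union> ?R = {..<2 * n}" by auto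
  then have "card (?L \<union> ?R) = 2 * n" by (simp only: card_lessThan)
  moreover have "card (?L \<times> ?R) = n\<^sup>2" by (simp add: card_cartesian_product power2_eq_square)
  moreover have "?L \<inter> ?R = {}" by auto
  ultimately have LR: "card (?L \<times> ?R) = n\<^sup>2" "card (?L \<union> ?R) = 2 * n" "?L \<inter> ?R = {}"
    by blast+
  have "\<alpha> / (\<alpha> + 1) \<le> 1" "0 \<le> \<alpha> / (\<alpha> + 1)" using \<alpha> by auto
  then have "real n powr 0 \<le> real n powr (2 - \<alpha> / (\<alpha> + 1))"
    "real n powr (2 - \<alpha> / (\<alpha> + 1)) \<le> real n powr 2"
    using n by (intro powr_mono; linarith)+
  then have x: "1 \<le> x" "x \<le> (real n)\<^sup>2" unfolding x_def using n by auto
  \<comment> \<open>Rounding down a number that is at least 1 loses at most half of it.\<close>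
  have "real m = real_of_int \<lfloor>x\<rfloor>" using x by (simp add: m_def)
  moreover have "\<lfloor>x\<rfloor> \<ge> 1" using x by simp
  ultimately have m: "real m \<le> x" "x / 2 \<le> real m" by linarith+
  have mn: "m \<le> n\<^sup>2" using m x by (metis of_nat_le_iff of_nat_power order_trans)
  have "p \<le> x / (real n)\<^sup>2" unfolding p_def using m by (intro divide_right_mono) auto
  also have "\<dots> = real n powr (- \<alpha> / (\<alpha> + 1))"
    using n by (simp add: x_def powr_diff powr_minus_divide)
  finally have p1: "p \<le> real n powr (- \<alpha> / (\<alpha> + 1))" .
  have p: "p \<le> d powr (-\<alpha>)" using p1 by (simp add: d_def powr_powr)
  have "real n * p \<le> real n powr 1 * real n powr (- \<alpha> / (\<alpha> + 1))"
    using p1 n by simp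
  also have "\<dots> = real n powr (1 + - \<alpha> / (\<alpha> + 1))" by (rule powr_add[symmetric])
  also have "1 + - \<alpha> / (\<alpha> + 1) = 1 / (\<alpha> + 1)" using \<alpha> by (simp add: field_simps)
  finally have np: "real n * p \<le> d" by (simp add: d_def)
  have "real n = d powr (\<alpha> + 1)" using \<alpha> n by (simp add: d_def powr_powr)
  also have "\<dots> \<le> d powr 2" using \<alpha> d by (intro powr_mono) auto
  finally have nd: "real n \<le> d\<^sup>2" using d by simp
  have "(real n)\<^sup>2 * (\<Sum>s=1..2 * n. real (2 * n choose s) *
      (real (s\<^sup>2 choose excess \<alpha> d s) * p ^ (s + excess \<alpha> d s)))
    \<le> (real n)\<^sup>2 * (\<Sum>s=1..2 * n. d powr (-7))"
    using \<alpha> d big' p np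
    by (intro mult_left_mono sum_mono union_bound_term) (auto simp: p_def)
  also have "\<dots> = 2 * real n ^ 3 * d powr (-7)" by (simp add: power2_eq_square power3_eq_cube)
  also have "\<dots> \<le> 2 * (d\<^sup>2) ^ 3 * d powr (-7)"
    using nd by (intro mult_right_mono mult_left_mono power_mono) auto
  also have "\<dots> = 2 * d powr (6 + -7)"
    using d unfolding powr_add by (simp flip: power_mult)
  also have "\<dots> = 2 / d" using d by (simp add: powr_minus_divide)
  also have "\<dots> < 1" using d by simp
  finally have "real (card (?L \<times> ?R)) * (\<Sum>s=1..card (?L \<union> ?R). real (card (?L \<union> ?R) choose s) *
      (real (s\<^sup>2 choose excess \<alpha> d s) * (real m / real (card (?L \<times> ?R))) ^ (s + excess \<alpha> d s))) < 1"
    unfolding LR p_def by simp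
  from exists_locally_sparse_edge_set[OF _ _ LR(3) _ this] mn
  obtain E where E: "E \<subseteq> ?L \<times> ?R" "card E = m" and sparse: "\<And>i j X. i \<in> ?L \<Longrightarrow> j \<in> ?R \<Longrightarrow>
      X \<subseteq> ?L \<union> ?R - {i, j} \<Longrightarrow> X \<noteq> {} \<Longrightarrow> {i} \<times> (X \<inter> ?R) \<union> (X \<inter> ?L) \<times> {j} \<subseteq> E \<Longrightarrow>
      card (E \<inter> X \<times> X) < excess \<alpha> d (card X)"
    unfolding LR by auto
  \<comment> \<open>The \<open>+ 1\<close> in \<open>excess\<close> turns the strict bound into one
    by the floor; where \<open>excess\<close> is 0 the premise is impossible.\<close>
  have ex: "real c \<le> 72 / \<alpha> * real s powr (2 - \<alpha>)" if "c < excess \<alpha> d s" for c s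
  proof -
    have "c \<le> nat \<lfloor>72 / \<alpha> * real s powr (2 - \<alpha>)\<rfloor>"
      using that by (simp add: excess_def split: if_splits)
    moreover have "72 / \<alpha> * real s powr (2 - \<alpha>) \<ge> 0" using \<alpha> by simp
    ultimately show ?thesis by linarith
  qed
  have cE: "real n powr (2 - \<alpha> / (\<alpha> + 1)) / 2 \<le> real (card E)"
    using m E(2) unfolding x_def by simp
  have "locally_sparse (\<lambda>x. 72 / \<alpha> * x powr (2 - \<alpha>)) ?L ?R E"
    unfolding locally_sparse_def by (intro ballI allI impI ex sparse; blast)
  with that n E(1) cE show thesis by blast
qed

section \<open>The two cases for \<alpha> and the final constants\<close>

theorem theorem10:
  fixes \<alpha> :: real
  assumes "0 \<le> \<alpha>" and "\<alpha> \<le> 1"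
  shows "\<exists>c C :: real. c > 0 \<and> C > 0 \<and>
    (\<forall>N :: nat. \<exists>G :: nat ugraph.
       finite_simple_graph G \<and> bipartite_graph G \<and> card (verts G) \<ge> N \<and>
       real (card (edges G)) \<ge> c * real (card (verts G)) powr (2 - \<alpha> / (\<alpha> + 1)) \<and>
       (\<forall>u\<in>verts G. \<forall>v\<in>verts G. u \<noteq> v \<longrightarrow>
          sparse_sub_bineighborhoods (\<lambda>x. C * x powr (2 - \<alpha>)) G u v))"
proof -
  \<comment> \<open>For \<alpha> = 0 the allowed bound is quadratic, and a set of x vertices spans
    at most x^2 pairs.\<close>
  define C where "C = (if \<alpha> = 0 then 1 else 72 / \<alpha>)"
  have C: "C > 0" using assms by (simp add: C_def)
  have "\<exists>G :: nat ugraph. finite_simple_graph G \<and> bipartite_graph G \<and> card (verts G) \<ge> N \<and>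
       real (card (edges G)) \<ge> 1/8 * real (card (verts G)) powr (2 - \<alpha> / (\<alpha> + 1)) \<and>
       (\<forall>u\<in>verts G. \<forall>v\<in>verts G. u \<noteq> v \<longrightarrow>
          sparse_sub_bineighborhoods (\<lambda>x. C * x powr (2 - \<alpha>)) G u v)" for N
  proof -
    obtain n E where n: "n \<ge> N" "n \<ge> 1" and E: "E \<subseteq> {..<n} \<times> {n..<2 * n}"
      and cE: "real n powr (2 - \<alpha> / (\<alpha> + 1)) / 2 \<le> real (card E)"
      and sparse: "locally_sparse (\<lambda>x. C * x powr (2 - \<alpha>)) {..<n} {n..<2 * n} E"
    proof (cases "\<alpha> = 0")
      case True
      define n where "n = N + 1"
      have n: "n \<ge> N" "n \<ge> 1" by (auto simp: n_def)
      have "real (card ({..<n} \<times> {n..<2 * n} \<inter> X \<times> X)) \<le> C * real (card X) powr (2 - \<alpha>)"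
        if "X \<subseteq> {..<n} \<union> {n..<2 * n} - {i, j}" for i j :: nat and X
      proof -
        have "finite X" by (rule finite_subset[OF that]) simp
        then have "card ({..<n} \<times> {n..<2 * n} \<inter> X \<times> X) \<le> card (X \<times> X)"
          by (intro card_mono) auto
        then have "card ({..<n} \<times> {n..<2 * n} \<inter> X \<times> X) \<le> (card X)\<^sup>2"
          by (simp add: card_cartesian_product power2_eq_square)
        then show ?thesis using True by (simp add: C_def flip: of_nat_power)
      qed
      then have "locally_sparse (\<lambda>x. C * x powr (2 - \<alpha>)) {..<n} {n..<2 * n} ({..<n} \<times> {n..<2 * n})"
        unfolding locally_sparse_def by blast
      moreover have "real n powr (2 - \<alpha> / (\<alpha> + 1)) / 2 \<le> real (card ({..<n} \<times> {n..<2 * n}))"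
        using True by (simp add: card_cartesian_product power2_eq_square)
      ultimately show thesis using that n by blast
    next
      case False
      then show thesis
        using exists_locally_sparse_powr[of \<alpha> N] that assms unfolding C_def by auto
    qed
    define G where "G = edge_graph {..<n} {n..<2 * n} E"
    have disj: "{..<n} \<inter> {n..<2 * n} = {}" by auto
    have cV: "card (verts G) = 2 * n" by (simp add: G_def card_Un_disjoint disj)
    \<comment> \<open>Passing from \<open>n\<close> to the 2 n vertices costs at most a factor 4,
      which with the 1/2 from rounding gives c = 1/8.\<close>
    have "(2::real) powr (2 - \<alpha> / (\<alpha> + 1)) \<le> 2 powr 2" using assms by (intro powr_mono) auto
    then have "(2::real) powr (2 - \<alpha> / (\<alpha> + 1)) * real n powr (2 - \<alpha> / (\<alpha> + 1))
        \<le> 4 * real n powr (2 - \<alpha> / (\<alpha> + 1))"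
      by (intro mult_right_mono) auto
    then have "1/8 * real (card (verts G)) powr (2 - \<alpha> / (\<alpha> + 1)) \<le> real (card E)"
      using cE unfolding cV by (simp add: powr_mult)
    moreover have "sparse_sub_bineighborhoods (\<lambda>x. C * x powr (2 - \<alpha>)) G u v"
      if "u \<in> verts G" "v \<in> verts G" for u v
      using that C unfolding G_def by (intro sparse_edge_graph sparse disj E) auto
    moreover have "finite_simple_graph G" "bipartite_graph G" "card (edges G) = card E"
      unfolding G_def
      by (intro finite_simple_edge_graph bipartite_edge_graph card_edges_edge_graph disj E; simp)+
    ultimately show ?thesis using n cV by (intro exI[of _ G]) simp
  qed
  with C show ?thesis by (intro exI[of _ "1/8"] exI[of _ C]) auto
qed

end
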